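(* Consider the optimization problem $\mathcal P$ described in the context, whose objective is $f(\boldsymbol\mu,\tau)=\rho_{\mathrm{com}}f_{\mathrm{com}}(\boldsymbol\mu)+\rho_{\mathrm{sen}}f_{\mathrm{sen}}(\tau)$. A set of weights ensuring that communications has higher hierarchy (than sensing) is given by $$\rho_{\mathrm{com}}=1,\qquad \rho_{\mathrm{sen}}=\frac{\sigma_{\mathrm{sen}}^2}{2\alpha N P_{\mathrm{tx}}}.$$
   Context: Let $N,U,L\ge1$ and $C\ge2$ be integers, $\mathcal N=\{1,\dots,N\}$, $\mathcal U=\{1,\dots,U\}$, $j=\sqrt{-1}$, and let $(\cdot)^{\mathrm T}$, $(\cdot)^{\mathrm H}$ denote transpose and conjugate transpose. Data: transmit power $P_{\mathrm{tx}}>0$; $\delta=\sqrt{P_{\mathrm{tx}}/N}$; $\mathcal S=\{\delta e^{j\phi_1},\dots,\delta e^{j\phi_L}\}$ for phases $\phi_1,\dots,\phi_L\in\mathbb R$; noise powers $\sigma_{\mathrm{com}}^2,\sigma_{\mathrm{sen}}^2>0$; channels $\mathbf h_u\in\mathbb C^{N\times1}$ and $\widetilde{\mathbf H}_u=\mathbf h_u\mathbf h_u^{\mathrm H}/\sigma_{\mathrm{com}}^2$; SNR threshold $\Gamma_{\mathrm{th}}\ge0$; reflection coefficient $\alpha>0$; steering vector $\mathbf a(\theta)\in\mathbb C^{N\times 1}$ with $n$-th entry $e^{j\pi\frac{2n-N-1}{2}\cos\theta}$; $\widetilde{\mathbf G}(\theta)=\alpha\,\mathbf a(\theta)\mathbf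 a^{\mathrm H}(\theta)/\sigma_{\mathrm{sen}}^2$; and, for a nominal target angle $\theta_0\in\mathbb R$ and uncertainty $\Delta\ge0$, $\Theta=\{\theta_0-\Delta+\tfrac{2\Delta}{C-1}c : c=0,\dots,C-1\}$. Problem $\mathcal P$: maximize $f(\boldsymbol\mu,\tau)$ over $\mathbf w\in\mathbb C^{N\times1}$, $\boldsymbol\mu=[\mu_1,\dots,\mu_U]^{\mathrm T}$, $\tau\in\mathbb R$, subject to $[\mathbf w]_n\in\mathcal S$ for all $n\in\mathcal N$; $\mu_u\in\{0,1\}$ for all $u\in\mathcal U$; $\mathbf w^{\mathrm H}\widetilde{\mathbf H}_u\mathbf w\ge\mu_u\Gamma_{\mathrm{th}}$ for all $u\in\mathcal U$; $\tau\ge0$; and $\mathbf w^{\mathrm H}\widetilde{\mathbf G}(\theta)\mathbf w\ge\tau$ for all $\theta\in\Theta$. Here $f_{\mathrm{com}}(\boldsymbol\mu)=\mathbf 1^{\mathrm T}\boldsymbol\mu=\sum_{u\in\mathcal U}\mu_u$ is the communications objective (number of admitted users), $f_{\mathrm{sen}}(\tau)=\tau$ is the sensing objective (lowest sensing SNR over the angles in $\Theta$), and $\rho_{\mathrm{com}},\rho_{\mathrm{sen}}$ are weights controlling the importance of the two functionalities. "Communications has higher hierarchy than sensing" means strictly tiered prioritization: communications is fully optimized before sensing is addressed, and sensing is supported opportunistically with the resources that remain. In terms of $\mathcal P$: every optimal solution of $\mathcal P$ attains the maximum of $f_{\mathrm{com}}$ over all feasible points and, among the feasible points attaining that maximum,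 maximizes $f_{\mathrm{sen}}$. *)

theory Defs
  imports "Jordan_Normal_Form.Matrix"
begin

text \<open>
  All indices run from 0, so the mathematical indices \<open>n = 1, ..., N\<close>, \<open>u = 1, ..., U\<close> and
  \<open>l = 1, ..., L\<close> appear as \<open>n - 1\<close>, \<open>u - 1\<close> and \<open>l - 1\<close>.
\<close>

record isac =
  antennas :: nat
  users :: nat
  phases :: nat
  grid_size :: nat  \<comment> \<open>\<open>C\<close>, the number of angles in \<open>\<Theta>\<close>\<close>
  P_tx :: real
  phase :: "nat \<Rightarrow> real"
  sigma2_com :: real  \<comment> \<open>noise powers, i.e. the squares \<open>\<sigma>\<^sup>2\<close> themselves\<close>
  sigma2_sen :: real
  channel :: "nat \<Rightarrow> complex vec"
  Gamma_th :: real
  refl_coeff :: real  \<comment> \<open>\<open>\<alpha>\<close>\<close>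
  theta0 :: real
  Delta :: real

definition isac_valid :: "isac \<Rightarrow> bool" where
  "isac_valid D \<longleftrightarrow>
     antennas D \<ge> 1 \<and> users D \<ge> 1 \<and> phases D \<ge> 1 \<and> grid_size D \<ge> 2 \<and>
     P_tx D > 0 \<and> sigma2_com D > 0 \<and> sigma2_sen D > 0 \<and>
     (\<forall>u<users D. channel D u \<in> carrier_vec (antennas D)) \<and>
     Gamma_th D \<ge> 0 \<and> refl_coeff D > 0 \<and> Delta D \<ge> 0"

text \<open>\<open>v v\<^sup>H\<close> and \<open>w\<^sup>H A w\<close>\<close>

definition outer :: "complex vec \<Rightarrow> complex mat" where
  "outer v = mat (dim_vec v) (dim_vec v) (\<lambda>(i, k). v $ i * cnj (v $ k))"

definition herm_form :: "complex mat \<Rightarrow> complex vec \<Rightarrow> complex" where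
  "herm_form A w = (A *\<^sub>v w) \<bullet>c w"

definition delta :: "isac \<Rightarrow> real" where
  "delta D = sqrt (P_tx D / real (antennas D))"

definition alphabet :: "isac \<Rightarrow> complex set" where
  "alphabet D = {complex_of_real (delta D) * exp (\<i> * complex_of_real (phase D l)) | l. l < phases D}"

definition H_tilde :: "isac \<Rightarrow> nat \<Rightarrow> complex mat" where
  "H_tilde D u = complex_of_real (1 / sigma2_com D) \<cdot>\<^sub>m outer (channel D u)"

definition steering :: "isac \<Rightarrow> real \<Rightarrow> complex vec" where
  "steering D \<theta> = vec (antennas D) (\<lambda>i.
     exp (\<i> * complex_of_real (pi * ((2 * (real i + 1) - real (antennas D) - 1) / 2) * cos \<theta>)))"

definition G_tilde :: "isac \<Rightarrow> real \<Rightarrow> complex mat" where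
  "G_tilde D \<theta> = complex_of_real (refl_coeff D / sigma2_sen D) \<cdot>\<^sub>m outer (steering D \<theta>)"

definition angles :: "isac \<Rightarrow> real set" where
  "angles D = {theta0 D - Delta D + 2 * Delta D / (real (grid_size D) - 1) * real c | c. c < grid_size D}"

text \<open>
  The matrices \<open>H_tilde D u\<close> and \<open>G_tilde D \<theta>\<close> are Hermitian, so the forms below are real
  (\<open>herm_form_outer_real\<close>) and taking \<^const>\<open>Re\<close> only changes the type.
\<close>

lemma herm_form_outer_real:
  assumes "v \<in> carrier_vec n" "w \<in> carrier_vec n"
  shows "herm_form (complex_of_real c \<cdot>\<^sub>m outer v) w \<in> \<real>"
proof -
  let ?s = "\<Sum>k = 0..<n. cnj (v $ k) * w $ k"
  have "herm_form (complex_of_real c \<cdot>\<^sub>m outer v) w =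
      (\<Sum>i = 0..<n. (\<Sum>k = 0..<n. of_real c * (v $ i * cnj (v $ k)) * w $ k) * cnj (w $ i))"
    using assms by (auto simp: herm_form_def outer_def scalar_prod_def intro!: sum.cong)
  also have "\<dots> = of_real c * (?s * cnj ?s)"
    by (simp add: sum_distrib_left sum_distrib_right mult_ac) (rule sum.swap)
  also have "\<dots> = of_real (c * (cmod ?s)\<^sup>2)"
    by (simp only: complex_norm_square of_real_mult)
  finally show ?thesis
    by simp
qed

type_synonym point = "complex vec \<times> real vec \<times> real"

definition feasible :: "isac \<Rightarrow> point \<Rightarrow> bool" where
  "feasible D = (\<lambda>(w, \<mu>, \<tau>).
     w \<in> carrier_vec (antennas D) \<and> \<mu> \<in> carrier_vec (users D) \<and>
     (\<forall>n<antennas D. w $ n \<in> alphabet D) \<and>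
     (\<forall>u<users D. \<mu> $ u \<in> {0, 1}) \<and>
     (\<forall>u<users D. Re (herm_form (H_tilde D u) w) \<ge> \<mu> $ u * Gamma_th D) \<and>
     \<tau> \<ge> 0 \<and>
     (\<forall>\<theta>\<in>angles D. Re (herm_form (G_tilde D \<theta>) w) \<ge> \<tau>))"

definition f_com :: "isac \<Rightarrow> point \<Rightarrow> real" where
  "f_com D = (\<lambda>(w, \<mu>, \<tau>). \<Sum>u<users D. \<mu> $ u)"

definition f_sen :: "point \<Rightarrow> real" where
  "f_sen = (\<lambda>(w, \<mu>, \<tau>). \<tau>)"

definition objective :: "isac \<Rightarrow> real \<Rightarrow> real \<Rightarrow> point \<Rightarrow> real" where
  "objective D \<rho>_com \<rho>_sen p = \<rho>_com * f_com D p + \<rho>_sen * f_sen p"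

definition optimal :: "isac \<Rightarrow> real \<Rightarrow> real \<Rightarrow> point \<Rightarrow> bool" where
  "optimal D \<rho>_com \<rho>_sen = is_arg_max (objective D \<rho>_com \<rho>_sen) (feasible D)"

definition com_higher_hierarchy :: "isac \<Rightarrow> real \<Rightarrow> real \<Rightarrow> bool" where
  "com_higher_hierarchy D \<rho>_com \<rho>_sen \<longleftrightarrow>
     (\<forall>p. optimal D \<rho>_com \<rho>_sen p \<longrightarrow>
        is_arg_max (f_com D) (feasible D) p \<and>
        is_arg_max f_sen (is_arg_max (f_com D) (feasible D)) p)"

end

theory Submission
  imports Defs
begin

text \<open>
  By the triangle inequality \<open>\<bar>a\<^sup>H w\<bar> \<le> N \<delta>\<close>, so every feasible \<open>\<tau>\<close> is at most
  \<open>\<alpha> N\<^sup>2 \<delta>\<^sup>2 / \<sigma>\<^sup>2 = \<alpha> N P / \<sigma>\<^sup>2\<close> and the weighted sensing term lies in \<open>[0, 1/2]\<close>. The communications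
  term is an integer, so no sensing gain can pay for the loss of a single user.
\<close>

text \<open>The double sum splits into v^H w times its conjugate. Unlike
  \<open>herm_form_outer_real\<close>, this keeps the value of the form, which the SNR bound
  needs.\<close>

lemma herm_form_scaled_outer:
  assumes "v \<in> carrier_vec n" "w \<in> carrier_vec n"
  shows "herm_form (complex_of_real c \<cdot>\<^sub>m outer v) w =
    of_real (c * (cmod (\<Sum>k = 0..<n. cnj (v $ k) * w $ k))\<^sup>2)"
proof -
  let ?s = "\<Sum>k = 0..<n. cnj (v $ k) * w $ k"
  have "herm_form (complex_of_real c \<cdot>\<^sub>m outer v) w =
      (\<Sum>i = 0..<n. (\<Sum>k = 0..<n. of_real c * (v $ i * cnj (v $ k)) * w $ k) * cnj (w $ i))"
    using assms by (auto simp: herm_form_def outer_def scalar_prod_def intro!: sum.cong)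
  also have "\<dots> = of_real c * (?s * cnj ?s)"
    by (simp add: sum_distrib_left sum_distrib_right mult_ac) (rule sum.swap)
  also have "\<dots> = of_real (c * (cmod ?s)\<^sup>2)"
    by (simp only: complex_norm_square of_real_mult)
  finally show ?thesis .
qed

lemma cmod_alphabet:
  assumes "isac_valid D" "z \<in> alphabet D"
  shows "cmod z = delta D"
  using assms by (auto simp: alphabet_def delta_def isac_valid_def norm_mult)

lemma sensing_snr_le:
  assumes D: "isac_valid D" and w: "w \<in> carrier_vec (antennas D)"
    and S: "\<forall>n<antennas D. w $ n \<in> alphabet D"
  shows "Re (herm_form (G_tilde D \<theta>) w) \<le> refl_coeff D * real (antennas D) * P_tx D / sigma2_sen D"
proof -
  let ?N = "antennas D"
  let ?s = "\<Sum>k = 0..<?N. cnj (steering D \<theta> $ k) * w $ k"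
  have pos: "?N \<ge> 1" "P_tx D > 0" "sigma2_sen D > 0" "refl_coeff D > 0"
    using D by (auto simp: isac_valid_def)
  \<comment> \<open>Steering entries have modulus 1 and symbols have modulus \<open>delta D\<close>,
    so the bound does not depend on the angle.\<close>
  have "cmod ?s \<le> (\<Sum>k = 0..<?N. delta D)"
    using cmod_alphabet[OF D] S
    by (intro sum_norm_le) (simp add: steering_def norm_mult)
  then have "(cmod ?s)\<^sup>2 \<le> (real ?N * delta D)\<^sup>2"
    by (intro power_mono) simp_all
  \<comment> \<open>The power normalization of \<open>delta\<close> cancels one of the two factors
    N.\<close>
  also have "\<dots> = real ?N * P_tx D"
  proof -
    have "(delta D)\<^sup>2 = P_tx D / real ?N"
      using pos by (simp add: delta_def)
    then show ?thesis
      using pos by (simp add: power_mult_distrib) (simp add: power2_eq_square)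
  qed
  finally have "refl_coeff D / sigma2_sen D * (cmod ?s)\<^sup>2 \<le>
      refl_coeff D / sigma2_sen D * (real ?N * P_tx D)"
    using pos by (intro mult_left_mono) simp_all
  moreover have "steering D \<theta> \<in> carrier_vec ?N"
    by (simp add: steering_def)
  ultimately show ?thesis
    unfolding G_tilde_def herm_form_scaled_outer[OF \<open>steering D \<theta> \<in> _\<close> w] by (simp add: mult_ac)
qed

lemma f_sen_nonneg: "feasible D p \<Longrightarrow> f_sen p \<ge> 0"
  by (auto simp: feasible_def f_sen_def)

lemma f_sen_le:
  assumes D: "isac_valid D" and p: "feasible D p"
  shows "f_sen p \<le> refl_coeff D * real (antennas D) * P_tx D / sigma2_sen D"
proof -
  obtain w \<mu> \<tau> where [simp]: "p = (w, \<mu>, \<tau>)" by (cases p)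
  \<comment> \<open>This is the grid point with c = 0. A single angle is enough to cap \<tau>, since
    the SNR bound is uniform in the angle.\<close>
  have "theta0 D - Delta D \<in> angles D"
    using D by (auto simp: angles_def isac_valid_def intro!: exI[of _ 0])
  then have "\<tau> \<le> Re (herm_form (G_tilde D (theta0 D - Delta D)) w)"
    using p by (auto simp: feasible_def)
  also have "\<dots> \<le> refl_coeff D * real (antennas D) * P_tx D / sigma2_sen D"
    using p by (intro sensing_snr_le[OF D]) (auto simp: feasible_def)
  finally show ?thesis by (simp add: f_sen_def)
qed

lemma f_com_Ints:
  assumes "feasible D p"
  shows "f_com D p \<in> \<int>"
proof -
  obtain w \<mu> \<tau> where [simp]: "p = (w, \<mu>, \<tau>)" by (cases p)
  have "\<mu> $ u \<in> \<int>" if "u < users D" for u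
    using assms that by (auto simp: feasible_def)
  then show ?thesis
    by (auto simp: f_com_def intro!: Ints_sum)
qed

text \<open>Separates the exchange argument from the constants: the weighted sensing term must stay
  strictly below 1, the smallest possible gap between two user counts.\<close>

lemma com_higher_hierarchyI:
  assumes rho: "\<rho> > 0" and small: "\<And>p. feasible D p \<Longrightarrow> \<rho> * f_sen p < 1"
  shows "com_higher_hierarchy D 1 \<rho>"
  unfolding com_higher_hierarchy_def
proof (intro allI impI)
  fix p assume "optimal D 1 \<rho> p"
  then have p: "feasible D p"
    and obj: "\<forall>q. feasible D q \<longrightarrow> f_com D q + \<rho> * f_sen q \<le> f_com D p + \<rho> * f_sen p"
    unfolding optimal_def is_arg_max_linorder objective_def mult_1 by blast+
  have opt: "f_com D q + \<rho> * f_sen q \<le> f_com D p + \<rho> * f_sen p" if "feasible D q" for q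
    using obj that by blast
  have com: "f_com D q \<le> f_com D p" if q: "feasible D q" for q
  proof (rule ccontr)
    assume less: "\<not> f_com D q \<le> f_com D p"
    obtain a where "f_com D q = of_int a"
      using f_com_Ints[OF q] by (rule Ints_cases)
    moreover obtain b where "f_com D p = of_int b"
      using f_com_Ints[OF p] by (rule Ints_cases)
    \<comment> \<open>Distinct integers differ by at least 1, so q would beat p even with no sensing
      reward at all.\<close>
    ultimately have "f_com D q \<ge> f_com D p + 1" using less by simp
    moreover have "0 \<le> \<rho> * f_sen q"
      using rho f_sen_nonneg[OF q] by simp
    ultimately show False
      using opt[OF q] small[OF p] by linarith
  qed
  then have "is_arg_max (f_com D) (feasible D) p"
    using p unfolding is_arg_max_linorder by blast
  \<comment> \<open>Since q admits at least as many users as p, optimality of p leaves only the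
    sensing terms to compare.\<close>
  moreover have "f_sen q \<le> f_sen p" if "is_arg_max (f_com D) (feasible D) q" for q
  proof -
    have "feasible D q" "f_com D p \<le> f_com D q"
      using that p unfolding is_arg_max_linorder by blast+
    then have "\<rho> * f_sen q \<le> \<rho> * f_sen p"
      using opt[of q] by linarith
    with rho show ?thesis by simp
  qed
  ultimately show "is_arg_max (f_com D) (feasible D) p \<and>
      is_arg_max f_sen (is_arg_max (f_com D) (feasible D)) p"
    unfolding is_arg_max_linorder[of f_sen] by blast
qed

theorem lemma1:
  fixes D :: isac
  assumes "isac_valid D"
  shows "com_higher_hierarchy D 1 (sigma2_sen D / (2 * refl_coeff D * real (antennas D) * P_tx D))"
    (is "com_higher_hierarchy D 1 ?rho")
proof (rule com_higher_hierarchyI)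
  have pos: "antennas D > 0" "P_tx D > 0" "sigma2_sen D > 0" "refl_coeff D > 0"
    using assms by (auto simp: isac_valid_def)
  then show rho: "?rho > 0" by simp
  fix p assume "feasible D p"
  then have "?rho * f_sen p \<le> ?rho * (refl_coeff D * real (antennas D) * P_tx D / sigma2_sen D)"
    using rho f_sen_le[OF assms] by (intro mult_left_mono) simp_all
  \<comment> \<open>The factor 2 in the weight provides the strictness: without it this bound would
    be exactly 1.\<close>
  also have "\<dots> = 1 / 2"
    using pos by (simp add: field_simps)
  finally show "?rho * f_sen p < 1" by linarith
qed

end
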